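(* Let $\alpha>1/2$. There is no online algorithm for the strict dynamic case of unweighted \textsc{MaximumIndependentSet} in unit disk graphs that has competitive ratio $\alpha$ and an amortized migration factor bounded by a constant (independent of the instance), when the migration potential of a step is the (absolute) area difference of consecutive instances.
   Context: Unit disk graph: the vertices are closed disks of radius $1$ in the plane, and two vertices are adjacent iff the disks intersect (tangent disks count as intersecting). An independent set is a set of pairwise non-intersecting disks, and its profit is its cardinality. Strict dynamic case: the instance starts empty, and at each step one disk arrives or one present disk departs. The algorithm outputs an independent set $S_t$ at each time without knowledge of the future. Competitive ratio $\alpha$ means $|S_t|\ge\alpha\,\mathrm{opt}(I_t)$ for all $t$. The migration potential of step $t$ is $|\mathrm{area}(I_t)-\mathrm{area}(I_{t-1})|$, where $\mathrm{area}(I)$ is the area of the union of the disks in $I$. The migration cost of changing $S_{t-1}$ to $S_t$ is the total area of the disks in $S_{t-1}\triangle S_t$ (i.e. $\pi$ per disk), excluding the initial inclusion of a newly arrived disk. A bounded amortized migration factor $B$ means that for all $t$ the total migration cost up to $t$ is at most $B$ times the total migration potential up to $t$. *)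

theory Defs
  imports "HOL-Analysis.Analysis"
begin

type_synonym disk = "(real ^ 2) set"

definition unit_disk :: "disk \<Rightarrow> bool" where
  "unit_disk D \<longleftrightarrow> (\<exists>c. D = cball c 1)"

text \<open>
  Tangent closed disks share a point, so two distinct disks are non-adjacent in the unit disk
  graph exactly if they are disjoint as sets.
\<close>

definition independent_set :: "disk set \<Rightarrow> disk set \<Rightarrow> bool" where
  "independent_set I S \<longleftrightarrow> S \<subseteq> I \<and> pairwise disjnt S"

definition opt :: "disk set \<Rightarrow> nat" where
  "opt I = Max (card ` {S. independent_set I S})"

definition area :: "disk set \<Rightarrow> real" where
  "area I = measure lebesgue (\<Union>I)"

datatype event = Arrive disk | Depart disk

primrec apply_event :: "disk set \<Rightarrow> event \<Rightarrow> disk set" where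
  "apply_event I (Arrive D) = insert D I"
| "apply_event I (Depart D) = I - {D}"

text \<open>The set of disks present after the given events, starting from the empty instance.\<close>

definition present :: "event list \<Rightarrow> disk set" where
  "present es = foldl apply_event {} es"

definition valid_events :: "event list \<Rightarrow> bool" where
  "valid_events es \<longleftrightarrow>
     (\<forall>t < length es. case es ! t of
        Arrive D \<Rightarrow> unit_disk D \<and> D \<notin> present (take t es)
      | Depart D \<Rightarrow> D \<in> present (take t es))"

text \<open>
  A (deterministic) online algorithm maps the events seen so far to its current solution; it may
  use the whole past, and its own earlier solutions are determined by prefixes of its argument.
  The solution \<open>S\<^sub>t\<close> on the event sequence \<open>es\<close> is thus \<open>alg (take t es)\<close>.
\<close>

type_synonym algorithm = "event list \<Rightarrow> disk set"

definition online_algorithm :: "algorithm \<Rightarrow> bool" where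
  "online_algorithm alg \<longleftrightarrow>
     (\<forall>es. valid_events es \<longrightarrow> (\<forall>t \<le> length es.
        independent_set (present (take t es)) (alg (take t es))))"

definition competitive_ratio :: "algorithm \<Rightarrow> real \<Rightarrow> bool" where
  "competitive_ratio alg \<alpha> \<longleftrightarrow>
     (\<forall>es. valid_events es \<longrightarrow> (\<forall>t \<le> length es.
        real (card (alg (take t es))) \<ge> \<alpha> * real (opt (present (take t es)))))"

text \<open>Step \<open>t\<close> (counted from 1) leads from time \<open>t - 1\<close> to time \<open>t\<close>.\<close>

definition migration_potential :: "event list \<Rightarrow> nat \<Rightarrow> real" where
  "migration_potential es t = \<bar>area (present (take t es)) - area (present (take (t - 1) es))\<bar>"

text \<open>
  The newly arrived disk of step \<open>t\<close>, if any, is the element of \<open>I\<^sub>t - I\<^sub>t\<^sub>-\<^sub>1\<close>. It is not in the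
  previous solution, so leaving it out only waives its inclusion upon arrival. The removal of
  a departing disk from the solution and the inclusion of a disk after its arrival step are
  both counted.
\<close>

definition migration_cost :: "algorithm \<Rightarrow> event list \<Rightarrow> nat \<Rightarrow> real" where
  "migration_cost alg es t =
     (let S = alg (take (t - 1) es); S' = alg (take t es);
          new = present (take t es) - present (take (t - 1) es)
      in \<Sum>D \<in> ((S - S') \<union> (S' - S)) - new. area {D})"

definition amortized_migration_factor :: "algorithm \<Rightarrow> real \<Rightarrow> bool" where
  "amortized_migration_factor alg B \<longleftrightarrow>
     (\<forall>es. valid_events es \<longrightarrow> (\<forall>t \<le> length es.
        (\<Sum>s = 1..t. migration_cost alg es s) \<le> B * (\<Sum>s = 1..t. migration_potential es s)))"

end

theory Submission
  imports Defs
begin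

text \<open>
  Two disks whose centres are at distance \<open>\<epsilon>\<close> form an instance with optimum 1, so the algorithm has
  to select one of them. The adversary lets a selected disk depart and re-inserts it, over and over.
  Each round costs at least the area \<open>v\<close> of a disk, because the solution loses a disk, while the union of
  the present disks changes its area only by \<open>O(\<epsilon> v)\<close>.
\<close>

lemma present_Nil [simp]: "present [] = {}"
  by (simp add: present_def)

lemma present_snoc [simp]: "present (es @ [e]) = apply_event (present es) e"
  by (simp add: present_def)

lemma valid_events_Nil [simp]: "valid_events []"
  by (simp add: valid_events_def)

lemma valid_events_snoc:
  "valid_events (es @ [e]) \<longleftrightarrow> valid_events es \<and>
     (case e of Arrive D \<Rightarrow> unit_disk D \<and> D \<notin> present es | Depart D \<Rightarrow> D \<in> present es)"
  by (auto simp: valid_events_def nth_append All_less_Suc cong: event.case_cong)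

lemma finite_present: "finite (present es)"
proof (induction es rule: rev_induct)
  case (snoc e es)
  then show ?case by (cases e) auto
qed simp

lemma opt_pos:
  assumes "finite I" "I \<noteq> {}"
  shows "0 < opt I"
proof -
  from assms obtain D where "D \<in> I" by blast
  then have "card {D} \<in> card ` {S. independent_set I S}"
    by (intro imageI) (simp add: independent_set_def)
  moreover have "finite (card ` {S. independent_set I S})"
    using assms by (auto simp: independent_set_def intro: finite_subset[of _ "Pow I"])
  ultimately have "card {D} \<le> opt I"
    unfolding opt_def by (rule Max_ge[rotated])
  then show ?thesis by simp
qed

text \<open>A single disk is independent, so a nonempty instance has positive optimum and a positive
  ratio rules out the empty solution. This is how competitiveness enters the argument: the adversary
  always finds a selected disk to remove.\<close>

lemma competitive_alg_nonempty:
  assumes "competitive_ratio alg \<alpha>" "\<alpha> > 0" "valid_events es" "present es \<noteq> {}"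
  shows "alg es \<noteq> {}"
proof
  assume "alg es = {}"
  moreover have "\<alpha> * real (opt (present es)) \<le> real (card (alg es))"
    using assms(1,3) unfolding competitive_ratio_def by (metis order_refl take_all_iff)
  moreover have "0 < \<alpha> * real (opt (present es))"
    using opt_pos[OF finite_present assms(4)] assms(2) by simp
  ultimately show False by simp
qed

lemma online_alg_subset:
  assumes "online_algorithm alg" "valid_events es"
  shows "alg es \<subseteq> present es"
  using assms unfolding online_algorithm_def independent_set_def
  by (metis order_refl take_all_iff)

lemma area_nonneg: "0 \<le> area I"
  by (simp add: area_def)

lemma migration_cost_nonneg: "0 \<le> migration_cost alg es t"
  by (simp add: migration_cost_def Let_def sum_nonneg area_nonneg)

text \<open>The cost of a step depends only on the prefixes just before and after it, which an
  appended event leaves alone. Totals can therefore be tracked event by event.\<close>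

lemma sum_migration_cost_snoc:
  "(\<Sum>s = 1..length (es @ [e]). migration_cost alg (es @ [e]) s) =
     (\<Sum>s = 1..length es. migration_cost alg es s) +
     migration_cost alg (es @ [e]) (Suc (length es))"
proof -
  have "(\<Sum>s = 1..length es. migration_cost alg (es @ [e]) s) =
      (\<Sum>s = 1..length es. migration_cost alg es s)"
    by (intro sum.cong) (auto simp: migration_cost_def)
  then show ?thesis by simp
qed

lemma sum_migration_potential_snoc:
  "(\<Sum>s = 1..length (es @ [e]). migration_potential (es @ [e]) s) =
     (\<Sum>s = 1..length es. migration_potential es s) +
     \<bar>area (apply_event (present es) e) - area (present es)\<bar>"
proof -
  have "(\<Sum>s = 1..length es. migration_potential (es @ [e]) s) =
      (\<Sum>s = 1..length es. migration_potential es s)"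
    by (intro sum.cong) (auto simp: migration_potential_def)
  then show ?thesis by (simp add: migration_potential_def)
qed

text \<open>The new solution consists of present disks, so it has lost \<open>D\<close>. A departure
  brings no new disk, hence nothing in the symmetric difference is exempt from the cost.\<close>

lemma migration_cost_Depart:
  assumes "online_algorithm alg" "valid_events (es @ [Depart D])" "D \<in> alg es"
  shows "area {D} \<le> migration_cost alg (es @ [Depart D]) (Suc (length es))"
proof -
  let ?S = "alg es" and ?S' = "alg (es @ [Depart D])"
  have valid: "valid_events es"
    using assms(2) by (simp add: valid_events_snoc)
  have S: "?S \<subseteq> present es" and S': "?S' \<subseteq> present es - {D}"
    using online_alg_subset[OF assms(1) valid] online_alg_subset[OF assms(1,2)] by auto
  have "finite ((?S - ?S') \<union> (?S' - ?S))"
    using S S' finite_present[of es] by (auto intro: finite_subset)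
  then have "area {D} \<le> (\<Sum>D \<in> (?S - ?S') \<union> (?S' - ?S). area {D})"
    using S' assms(3) by (intro member_le_sum) (auto simp: area_nonneg)
  moreover have no_new: "present es - {D} - present es = {}" by blast
  ultimately show ?thesis
    by (simp add: migration_cost_def Let_def no_new)
qed

text \<open>Invariant after \<open>n\<close> rounds. The two initial arrivals have potential at most
  \<open>v + \<delta>\<close>; each round changes the union twice, by at most
  \<open>\<delta>\<close> each time, and costs at least \<open>v\<close>. Both disks are present
  again at the end, so the next round can start.\<close>

lemma two_disk_adversary:
  assumes alg: "online_algorithm alg" "competitive_ratio alg \<alpha>" "\<alpha> > 0"
    and disks: "unit_disk D1" "unit_disk D2" "D1 \<noteq> D2"
    and area: "area {D1} = v" "area {D2} = v" "v \<le> area {D1, D2}" "area {D1, D2} \<le> v + \<delta>"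
  shows "\<exists>es. valid_events es \<and> present es = {D1, D2} \<and>
    real n * v \<le> (\<Sum>s = 1..length es. migration_cost alg es s) \<and>
    (\<Sum>s = 1..length es. migration_potential es s) \<le> v + \<delta> + 2 * real n * \<delta>"
proof (induction n)
  case 0
  let ?es = "([] @ [Arrive D1]) @ [Arrive D2]"
  have "valid_events ?es" "present ?es = {D1, D2}"
    unfolding valid_events_snoc present_snoc using disks by auto
  moreover have "(\<Sum>s = 1..length ?es. migration_potential ?es s) \<le> v + \<delta>"
    unfolding sum_migration_potential_snoc present_snoc using area area_nonneg[of "{D1}"]
    by (simp add: insert_commute area_def[of "{}"])
  moreover have "0 \<le> (\<Sum>s = 1..length ?es. migration_cost alg ?es s)"
    by (intro sum_nonneg migration_cost_nonneg)
  ultimately show ?case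
    by (intro exI[of _ ?es]) simp
next
  case (Suc n)
  then obtain es where es: "valid_events es" "present es = {D1, D2}"
    "real n * v \<le> (\<Sum>s = 1..length es. migration_cost alg es s)"
    "(\<Sum>s = 1..length es. migration_potential es s) \<le> v + \<delta> + 2 * real n * \<delta>"
    by blast
  obtain D where D: "D \<in> alg es"
    using competitive_alg_nonempty[OF alg(2,3) es(1)] es(2) by auto
  then have D_cases: "D = D1 \<or> D = D2"
    using online_alg_subset[OF alg(1) es(1)] es(2) by blast
  \<comment> \<open>Whichever disk departs, the remaining one has area \<open>v\<close>, so the
    departure and the re-arrival both have potential \<open>area {D1, D2} - v\<close>.\<close>
  then have rest: "area ({D1, D2} - {D}) = v"
    using disks(3) area by (auto simp: insert_Diff_if)
  let ?es1 = "es @ [Depart D]"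
  let ?es2 = "?es1 @ [Arrive D]"
  have valid: "valid_events ?es1" "valid_events ?es2"
    using es(1,2) D_cases disks(1,2) by (auto simp: valid_events_snoc simp del: append_assoc)
  have reinsert: "insert D ({D1, D2} - {D}) = {D1, D2}"
    using D_cases by auto
  have "present ?es2 = {D1, D2}"
    by (simp only: present_snoc es apply_event.simps reinsert)
  moreover have "(\<Sum>s = 1..length ?es2. migration_potential ?es2 s)
      \<le> v + \<delta> + 2 * real (Suc n) * \<delta>"
    unfolding sum_migration_potential_snoc present_snoc es(2) apply_event.simps reinsert rest
    using es(4) area(3,4) by (simp add: algebra_simps)
  moreover have "real (Suc n) * v \<le> (\<Sum>s = 1..length ?es2. migration_cost alg ?es2 s)"
  proof -
    have "area {D} = v"
      using D_cases area by auto
    then show ?thesis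
      unfolding sum_migration_cost_snoc
      \<comment> \<open>The departure alone pays \<open>v\<close>; the cost of the re-arrival is
        bounded below by 0.\<close>
      using es(3) migration_cost_Depart[OF alg(1) valid(1) D]
        migration_cost_nonneg[of alg ?es2 "Suc (length ?es1)"]
      by (simp only:) (simp add: algebra_simps)
  qed
  ultimately show ?case
    using valid(2) by blast
qed

text \<open>Unit disks centred at 0 and at a point of norm \<open>\<epsilon>\<close> both lie in the
  disk of radius \<open>1 + \<epsilon>\<close> around 0, and \<open>(1 + \<epsilon>)\<close> squared
  is at most \<open>1 + 3 * \<epsilon>\<close> for \<open>\<epsilon> \<le> 1\<close>.\<close>

lemma exists_close_unit_disks:
  assumes "0 < \<epsilon>" "\<epsilon> \<le> 1"
  obtains D1 D2 where "unit_disk D1" "unit_disk D2" "D1 \<noteq> D2"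
    "area {D1} = unit_ball_vol 2" "area {D2} = unit_ball_vol 2"
    "unit_ball_vol 2 \<le> area {D1, D2}"
    "area {D1, D2} \<le> unit_ball_vol 2 + 3 * \<epsilon> * unit_ball_vol 2"
proof -
  obtain c :: "real ^ 2" where c: "norm c = \<epsilon>"
    using vector_choose_size[of \<epsilon>] assms(1) by auto
  let ?D1 = "cball (0 :: real ^ 2) 1" and ?D2 = "cball c 1"
  have vol: "measure lebesgue (cball a r) = unit_ball_vol 2 * r\<^sup>2" if "0 \<le> r"
    for a :: "real ^ 2" and r
    using content_cball[OF that, of a] by simp
  have "?D2 \<subseteq> cball 0 (1 + \<epsilon>)"
    using c by (auto simp: cball_subset_cball_iff)
  then have "?D1 \<union> ?D2 \<subseteq> cball 0 (1 + \<epsilon>)"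
    using assms by auto
  then have "measure lebesgue (?D1 \<union> ?D2) \<le> measure lebesgue (cball (0 :: real ^ 2) (1 + \<epsilon>))"
    by (intro measure_mono_fmeasurable) auto
  also have "\<dots> = unit_ball_vol 2 * (1 + \<epsilon>)\<^sup>2"
    using vol assms by simp
  also have "\<dots> \<le> unit_ball_vol 2 * (1 + 3 * \<epsilon>)"
  proof (rule mult_left_mono)
    have "\<epsilon> * \<epsilon> \<le> \<epsilon>"
      using assms by (simp add: mult_left_le)
    then show "(1 + \<epsilon>)\<^sup>2 \<le> 1 + 3 * \<epsilon>"
      by (simp add: power2_eq_square algebra_simps)
  qed simp
  finally have upper: "area {?D1, ?D2} \<le> unit_ball_vol 2 + 3 * \<epsilon> * unit_ball_vol 2"
    by (simp add: area_def algebra_simps)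
  have "measure lebesgue ?D1 \<le> measure lebesgue (?D1 \<union> ?D2)"
    by (intro measure_mono_fmeasurable) auto
  then have "unit_ball_vol 2 \<le> area {?D1, ?D2}"
    using vol[of 1 0] by (simp add: area_def)
  moreover have "?D1 \<noteq> ?D2"
    using c assms by (auto simp: cball_eq_cball_iff)
  moreover have "area {?D1} = unit_ball_vol 2" "area {?D2} = unit_ball_vol 2"
    using vol[of 1] by (simp_all add: area_def)
  ultimately show thesis
    using that[of ?D1 ?D2] upper by (auto simp: unit_disk_def)
qed

theorem theorem23:
  fixes \<alpha> :: real
  assumes "\<alpha> > 1 / 2"
  shows "\<not> (\<exists>alg. online_algorithm alg \<and> competitive_ratio alg \<alpha> \<and>
               (\<exists>B::real. amortized_migration_factor alg B))"
proof
  assume "\<exists>alg. online_algorithm alg \<and> competitive_ratio alg \<alpha> \<and>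
               (\<exists>B::real. amortized_migration_factor alg B)"
  then obtain alg B where alg: "online_algorithm alg" "competitive_ratio alg \<alpha>"
    and B: "amortized_migration_factor alg B" by blast
  define v :: real where "v = unit_ball_vol 2"
  have "v > 0"
    by (simp add: v_def)
  \<comment> \<open>A round has potential at most \<open>6 * \<epsilon> * v\<close>; this choice
    makes \<open>\<bar>B\<bar>\<close> times that at most \<open>v / 2\<close>, half the cost of the
    round. The summand 1 covers \<open>B = 0\<close>.\<close>
  define \<epsilon> where "\<epsilon> = 1 / (12 * (\<bar>B\<bar> + 1))"
  have \<epsilon>: "0 < \<epsilon>" "\<epsilon> \<le> 1" "12 * \<epsilon> * \<bar>B\<bar> \<le> 1"
    by (auto simp: \<epsilon>_def field_simps)
  obtain D1 D2 where disks: "unit_disk D1" "unit_disk D2" "D1 \<noteq> D2"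
    and area: "area {D1} = v" "area {D2} = v" "v \<le> area {D1, D2}"
      "area {D1, D2} \<le> v + 3 * \<epsilon> * v"
    using exists_close_unit_disks[OF \<epsilon>(1,2)] unfolding v_def by metis
  \<comment> \<open>The initial potential is at most \<open>4 * v\<close> because
    \<open>\<epsilon> \<le> 1\<close>. The final estimate thus gives
    \<open>n \<le> 4 * \<bar>B\<bar> + n / 2\<close>, that is
    \<open>n \<le> 8 * \<bar>B\<bar>\<close>.\<close>
  obtain n :: nat where n: "8 * \<bar>B\<bar> < real n"
    using reals_Archimedean2 by blast
  obtain es where es: "valid_events es"
    "real n * v \<le> (\<Sum>s = 1..length es. migration_cost alg es s)"
    "(\<Sum>s = 1..length es. migration_potential es s)
      \<le> v + 3 * \<epsilon> * v + 2 * real n * (3 * \<epsilon> * v)"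
    using two_disk_adversary[OF alg _ disks area, of n] assms by auto
  let ?P = "\<Sum>s = 1..length es. migration_potential es s"
  have "0 \<le> ?P"
    by (intro sum_nonneg) (simp add: migration_potential_def)
  have "real n * v \<le> B * ?P"
    using es(1,2) B unfolding amortized_migration_factor_def by fastforce
  \<comment> \<open>\<open>B\<close> may be negative; with \<open>\<bar>B\<bar>\<close> the upper
    bound on the potential can be inserted.\<close>
  also have "\<dots> \<le> \<bar>B\<bar> * ?P"
    using \<open>0 \<le> ?P\<close> by (intro mult_right_mono) auto
  also have "\<dots> \<le> \<bar>B\<bar> * (v + 3 * \<epsilon> * v + 2 * real n * (3 * \<epsilon> * v))"
    using es(3) by (intro mult_left_mono) auto
  also have "\<dots> = (\<bar>B\<bar> + 3 * \<epsilon> * \<bar>B\<bar> + real n * (6 * \<epsilon> * \<bar>B\<bar>)) * v"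
    by (simp add: algebra_simps)
  finally have "real n \<le> \<bar>B\<bar> + 3 * \<epsilon> * \<bar>B\<bar> + real n * (6 * \<epsilon> * \<bar>B\<bar>)"
    using \<open>v > 0\<close> by simp
  moreover have "\<epsilon> * \<bar>B\<bar> \<le> \<bar>B\<bar>"
    using \<epsilon>(1,2) by (simp add: mult_left_le_one_le)
  moreover have "real n * (6 * \<epsilon> * \<bar>B\<bar>) \<le> real n * (1 / 2)"
    using \<epsilon>(3) by (intro mult_left_mono) auto
  ultimately show False
    using n by linarith
qed

end
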